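(* Let $X\subseteq\mathbb{C}$ be non-empty, compact and radially self-absorbing. Let $\mathcal{F}$ be the set of injective rectifiable paths in $X$. Let $M=(M_n)_{n\ge0}$ be a sequence of positive numbers. Set $$S=\{f\in D(X,M): f \text{ extends to be analytic on a neighbourhood of } X\}.$$ Then $S$ is dense in $\mathcal{D}_{\mathcal{F}}(X,M)$.
   Context: A non-empty compact set $X\subseteq\mathbb{C}$ is radially self-absorbing if $X\subseteq\mathrm{int}(rX)$ for every real $r>1$. A function $f:X\to\mathbb{C}$ is complex-differentiable at $a\in X$ if $f'(a)=\lim_{z\to a,\,z\in X\setminus\{a\}}\frac{f(z)-f(a)}{z-a}$ exists; $D^\infty(X)$ is the set of infinitely complex-differentiable functions on $X$, with $n$-th derivative $f^{(n)}$ and $f^{(0)}=f$. $D(X,M)=\{f\in D^\infty(X):\|f\|=\sum_{n=0}^\infty \frac{\|f^{(n)}\|_\infty}{M_n}<\infty\}$, where $\|\cdot\|_\infty$ is the supremum norm on $X$. A path in $X$ is a continuous map $\gamma:[a,b]\to X$ with $a<b$ real; its endpoints are $\gamma^-=\gamma(a)$ and $\gamma^+=\gamma(b)$. For $f\in C(X)$ (continuous complex-valued functions on $X$), a function $g\in C(X)$ is an $\mathcal{F}$-derivative of $f$ if $\int_\gamma g(z)\,dz=f(\gamma^+)-f(\gamma^-)$ for every $\gamma\in\mathcal{F}$. For radially self-absorbing $X$ and $\mathcal{F}$ as in the claim, the union of the images of the paths in $\mathcal{F}$ is dense in $X$, so $\mathcal{F}$-derivatives are unique; the $n$-th $\mathcal{F}$-derivative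 is defined by iteration and also denoted $f^{(n)}$ (it agrees with the complex derivative whenever the latter exists and is continuous). $\mathcal{D}_{\mathcal{F}}(X,M)$ is the space of all $f\in C(X)$ which are infinitely $\mathcal{F}$-differentiable and satisfy $\|f\|=\sum_{n=0}^\infty\frac{\|f^{(n)}\|_\infty}{M_n}<\infty$, with this norm. It contains $D(X,M)$ isometrically. *)

theory Defs
  imports "HOL-Complex_Analysis.Complex_Analysis"
begin

text \<open>
  A function on a set X is represented by a total function of type complex => complex. All notions
  below depend on its values on X only.
\<close>

definition radially_self_absorbing :: "complex set \<Rightarrow> bool" where
  "radially_self_absorbing X \<longleftrightarrow>
     (\<forall>r::real. r > 1 \<longrightarrow> X \<subseteq> interior ((\<lambda>z. complex_of_real r * z) ` X))"

text \<open>
  The supremum is taken in the extended nonnegative reals, so that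
  a function that is unbounded on X has norm infinity.
\<close>

definition supnorm_on :: "complex set \<Rightarrow> (complex \<Rightarrow> complex) \<Rightarrow> ennreal" where
  "supnorm_on X f = (SUP z\<in>X. ennreal (cmod (f z)))"

definition weighted_norm ::
    "complex set \<Rightarrow> (nat \<Rightarrow> real) \<Rightarrow> (nat \<Rightarrow> complex \<Rightarrow> complex) \<Rightarrow> ennreal" where
  "weighted_norm X M h = (\<Sum>n. supnorm_on X (h n) / ennreal (M n))"


subsection \<open>Complex derivatives relative to a set\<close>

text \<open>
  The value is meaningful at points of X that are not isolated in X and at which f is
  differentiable within X.
\<close>

definition cderiv_on :: "complex set \<Rightarrow> (complex \<Rightarrow> complex) \<Rightarrow> complex \<Rightarrow> complex" where
  "cderiv_on X f a = (THE D. (f has_field_derivative D) (at a within X))"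

definition nth_cderiv_on :: "complex set \<Rightarrow> nat \<Rightarrow> (complex \<Rightarrow> complex) \<Rightarrow> complex \<Rightarrow> complex" where
  "nth_cderiv_on X n f = (cderiv_on X ^^ n) f"

definition D_infty :: "complex set \<Rightarrow> (complex \<Rightarrow> complex) set" where
  "D_infty X = {f. \<forall>n. \<forall>a\<in>X. nth_cderiv_on X n f field_differentiable (at a within X)}"

definition D_space :: "complex set \<Rightarrow> (nat \<Rightarrow> real) \<Rightarrow> (complex \<Rightarrow> complex) set" where
  "D_space X M = {f \<in> D_infty X. weighted_norm X M (\<lambda>n. nth_cderiv_on X n f) < \<infinity>}"


subsection \<open>Paths and path integrals\<close>

text \<open>A triple (a, b, \<gamma>) stands for the restriction of \<gamma> to the interval from a to b.\<close>

type_synonym cpath = "real \<times> real \<times> (real \<Rightarrow> complex)"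

definition is_path_in :: "complex set \<Rightarrow> cpath \<Rightarrow> bool" where
  "is_path_in X = (\<lambda>(a, b, \<gamma>). a < b \<and> continuous_on {a..b} \<gamma> \<and> \<gamma> ` {a..b} \<subseteq> X)"

text \<open>
  Finite length: the chord sums over all subdivisions of the parameter interval are bounded.
  A member K of a division is a closed interval, with end points Inf K and Sup K.
\<close>

definition rectifiable :: "cpath \<Rightarrow> bool" where
  "rectifiable = (\<lambda>(a, b, \<gamma>).
     \<exists>L::real. \<forall>d. d division_of {a..b} \<longrightarrow> (\<Sum>K\<in>d. dist (\<gamma> (Inf K)) (\<gamma> (Sup K))) \<le> L)"

text \<open>
  The integral of g along a path, as the limit of the Riemann--Stieltjes sums as the mesh tends
  to 0 (the gauge is the constant radius \<delta>). The library's contour integral is not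
  suitable, since a rectifiable path need not be piecewise differentiable, or even absolutely
  continuous.
\<close>

definition has_path_integral :: "(complex \<Rightarrow> complex) \<Rightarrow> complex \<Rightarrow> cpath \<Rightarrow> bool" where
  "has_path_integral g I = (\<lambda>(a, b, \<gamma>).
     \<forall>\<epsilon>>0. \<exists>\<delta>>0. \<forall>p. p tagged_division_of {a..b} \<and> (\<lambda>t. ball t \<delta>) fine p \<longrightarrow>
       cmod ((\<Sum>(t, K)\<in>p. g (\<gamma> t) * (\<gamma> (Sup K) - \<gamma> (Inf K))) - I) < \<epsilon>)"

definition injective_rectifiable_paths :: "complex set \<Rightarrow> cpath set" where
  "injective_rectifiable_paths X =
     {(a, b, \<gamma>). is_path_in X (a, b, \<gamma>) \<and> inj_on \<gamma> {a..b} \<and> rectifiable (a, b, \<gamma>)}"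


subsection \<open>Derivatives with respect to a family of paths\<close>

definition is_F_derivative ::
    "cpath set \<Rightarrow> complex set \<Rightarrow> (complex \<Rightarrow> complex) \<Rightarrow> (complex \<Rightarrow> complex) \<Rightarrow> bool" where
  "is_F_derivative \<F> X f g \<longleftrightarrow>
     continuous_on X f \<and> continuous_on X g \<and>
     (\<forall>(a, b, \<gamma>)\<in>\<F>. has_path_integral g (f (\<gamma> b) - f (\<gamma> a)) (a, b, \<gamma>))"

text \<open>
  When the images of the paths in the family have dense union in X, the derivative is unique on X,
  so the choice below only affects values outside X.
\<close>

definition F_derivative ::
    "cpath set \<Rightarrow> complex set \<Rightarrow> (complex \<Rightarrow> complex) \<Rightarrow> complex \<Rightarrow> complex" where
  "F_derivative \<F> X f = (SOME g. is_F_derivative \<F> X f g)"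

definition nth_F_derivative ::
    "cpath set \<Rightarrow> complex set \<Rightarrow> nat \<Rightarrow> (complex \<Rightarrow> complex) \<Rightarrow> complex \<Rightarrow> complex" where
  "nth_F_derivative \<F> X n f = (F_derivative \<F> X ^^ n) f"

definition infinitely_F_differentiable ::
    "cpath set \<Rightarrow> complex set \<Rightarrow> (complex \<Rightarrow> complex) \<Rightarrow> bool" where
  "infinitely_F_differentiable \<F> X f \<longleftrightarrow>
     (\<forall>n. \<exists>g. is_F_derivative \<F> X (nth_F_derivative \<F> X n f) g)"

definition DF_norm ::
    "cpath set \<Rightarrow> complex set \<Rightarrow> (nat \<Rightarrow> real) \<Rightarrow> (complex \<Rightarrow> complex) \<Rightarrow> ennreal" where
  "DF_norm \<F> X M f = weighted_norm X M (\<lambda>n. nth_F_derivative \<F> X n f)"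

definition DF_space ::
    "cpath set \<Rightarrow> complex set \<Rightarrow> (nat \<Rightarrow> real) \<Rightarrow> (complex \<Rightarrow> complex) set" where
  "DF_space \<F> X M =
     {f. continuous_on X f \<and> infinitely_F_differentiable \<F> X f \<and> DF_norm \<F> X M f < \<infinity>}"

definition dense_in_DF_space ::
    "cpath set \<Rightarrow> complex set \<Rightarrow> (nat \<Rightarrow> real) \<Rightarrow> (complex \<Rightarrow> complex) set \<Rightarrow> bool" where
  "dense_in_DF_space \<F> X M S \<longleftrightarrow>
     S \<subseteq> DF_space \<F> X M \<and>
     (\<forall>f\<in>DF_space \<F> X M. \<forall>\<epsilon>::real. \<epsilon> > 0 \<longrightarrow>
        (\<exists>g\<in>S. DF_norm \<F> X M (\<lambda>z. f z - g z) < ennreal \<epsilon>))"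

definition extends_analytically :: "complex set \<Rightarrow> (complex \<Rightarrow> complex) \<Rightarrow> bool" where
  "extends_analytically X f \<longleftrightarrow>
     (\<exists>U h. open U \<and> X \<subseteq> U \<and> h analytic_on U \<and> (\<forall>z\<in>X. h z = f z))"

end

theory Submission
  imports Defs
begin

text \<open>
  A radially self-absorbing set satisfies tX \<subseteq> interior X for 0 < t < 1. On the interior the
  derivative along paths is the complex derivative, as one sees by integrating along segments, so
  z \<mapsto> f (t z) is analytic on a neighbourhood of X and its n-th derivative is t^n f^(n)(t z). For
  t \<rightarrow> 1 each of these converges uniformly on X to f^(n) by uniform continuity, and since the n-th
  term of the norm of the difference is at most twice that of f, dominated convergence for series
  gives convergence in norm.
\<close>

text \<open>The weights are arbitrary, so approximating each derivative of f uniformly does not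
  control the tail of the norm series. Dilation does: as tX \<subseteq> X and t^n \<le> 1, it
  increases the supremum norm of no derivative, whatever M is. That S lies in the space at all is
  where rectifiable paths enter. Such a path need not be differentiable, so the fundamental theorem
  of calculus is proved directly on Riemann--Stieltjes sums, with an error controlled by the sum of
  the chords. \<open>F_derivative\<close> is a choice that fixes nothing off X. Iterated derivatives
  are therefore identified, on X only, with an explicit chain of functions. This rests on
  uniqueness, which follows from the density of the interior in X: each z in X is the limit of the
  interior points t z as t \<rightarrow> 1.\<close>

section \<open>Riemann--Stieltjes sums\<close>

lemma tagged_division_of_real_member:
  fixes a b :: real
  assumes "p tagged_division_of {a..b}" and "(t, K) \<in> p"
  obtains u v where "u \<le> t" "t \<le> v" "K = {u..v}" "Inf K = u" "Sup K = v" "a \<le> u" "v \<le> b"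
proof -
  have "t \<in> K" "K \<subseteq> {a..b}" "\<exists>u v. K = cbox u v"
    using tagged_division_ofD(2-4)[OF assms] by auto
  then obtain u v where "K = {u..v}" "u \<le> t" "t \<le> v"
    by auto
  moreover from this have "Inf K = u" "Sup K = v"
    by auto
  moreover have "a \<le> u" "v \<le> b"
    using \<open>K \<subseteq> {a..b}\<close> calculation(1-3) by auto
  ultimately show thesis
    using that by blast
qed

text \<open>Path integrals use tagged divisions, while \<open>rectifiable\<close> bounds sums over
  plain ones. Forgetting the tags can merge only pairs whose interval is a single point, and those
  have chord zero.\<close>

lemma sum_tagged_division_eq_sum_division:
  fixes \<gamma> :: "real \<Rightarrow> 'a::real_normed_vector"
  assumes p: "p tagged_division_of {a..b}"
  shows "(\<Sum>(t, K)\<in>p. dist (\<gamma> (Inf K)) (\<gamma> (Sup K)))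
    = (\<Sum>K\<in>snd ` p. dist (\<gamma> (Inf K)) (\<gamma> (Sup K)))"
proof -
  \<comment> \<open>\<open>sum.over_tagged_division_lemma\<close> also demands the value 0 on an
    empty \<open>cbox\<close>, where \<open>Inf\<close> and \<open>Sup\<close> are of no use; hence
    the case distinction.\<close>
  let ?d = "\<lambda>K. if K = {} then 0 else dist (\<gamma> (Inf K)) (\<gamma> (Sup K))"
  have ne: "K \<noteq> {}" if "(t, K) \<in> p" for t K
    using tagged_division_ofD(2)[OF p that] by blast
  have "(\<Sum>(t, K)\<in>p. ?d K) = (\<Sum>K\<in>snd ` p. ?d K)"
  proof (rule sum.over_tagged_division_lemma[OF p])
    show "?d (cbox u v) = 0" if "box u v = {}" for u v
      using that by auto
  qed
  moreover have "(\<Sum>(t, K)\<in>p. ?d K) = (\<Sum>(t, K)\<in>p. dist (\<gamma> (Inf K)) (\<gamma> (Sup K)))"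
    using ne by (intro sum.cong) auto
  moreover have "(\<Sum>K\<in>snd ` p. ?d K) = (\<Sum>K\<in>snd ` p. dist (\<gamma> (Inf K)) (\<gamma> (Sup K)))"
    using ne by (intro sum.cong) auto
  ultimately show ?thesis
    by simp
qed

lemma gauge_ball_const: "\<delta> > 0 \<Longrightarrow> gauge (\<lambda>t::real. ball t \<delta>)"
  by (simp add: gauge_def)

lemma has_path_integral_cong:
  assumes "\<gamma> ` {a..b} \<subseteq> X" and "\<And>z. z \<in> X \<Longrightarrow> g z = g' z"
  shows "has_path_integral g I (a, b, \<gamma>) \<longleftrightarrow> has_path_integral g' I (a, b, \<gamma>)"
proof -
  have "(\<Sum>(t, K)\<in>p. g (\<gamma> t) * (\<gamma> (Sup K) - \<gamma> (Inf K)))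
      = (\<Sum>(t, K)\<in>p. g' (\<gamma> t) * (\<gamma> (Sup K) - \<gamma> (Inf K)))"
    if "p tagged_division_of {a..b}" for p
  proof (rule sum.cong[OF refl], clarify)
    fix t K assume "(t, K) \<in> p"
    then have "t \<in> {a..b}"
      using tagged_division_ofD(2,3)[OF that] by blast
    then show "g (\<gamma> t) * (\<gamma> (Sup K) - \<gamma> (Inf K)) = g' (\<gamma> t) * (\<gamma> (Sup K) - \<gamma> (Inf K))"
      using assms by (metis image_subset_iff)
  qed
  then show ?thesis
    unfolding has_path_integral_def by (simp cong: conj_cong)
qed

lemma has_path_integralE:
  assumes "has_path_integral g I (a, b, \<gamma>)" and "e > 0"
  obtains \<delta> where "\<delta> > 0"
    and "\<And>p. p tagged_division_of {a..b} \<Longrightarrow> (\<lambda>t. ball t \<delta>) fine p \<Longrightarrow>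
          cmod ((\<Sum>(t, K)\<in>p. g (\<gamma> t) * (\<gamma> (Sup K) - \<gamma> (Inf K))) - I) < e"
proof -
  obtain \<delta> where \<delta>: "\<delta> > 0 \<and> (\<forall>p. p tagged_division_of {a..b} \<and> (\<lambda>t. ball t \<delta>) fine p \<longrightarrow>
      cmod ((\<Sum>(t, K)\<in>p. g (\<gamma> t) * (\<gamma> (Sup K) - \<gamma> (Inf K))) - I) < e)"
    using assms(1)[unfolded has_path_integral_def prod.case, THEN spec, THEN mp, OF assms(2)] ..
  show thesis
    by (rule that[OF conjunct1[OF \<delta>]]) (rule \<delta>[THEN conjunct2, THEN spec, THEN mp, OF conjI])
qed

lemma has_path_integral_diff:
  assumes "has_path_integral g I (a, b, \<gamma>)" and "has_path_integral h J (a, b, \<gamma>)"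
  shows "has_path_integral (\<lambda>z. g z - h z) (I - J) (a, b, \<gamma>)"
  unfolding has_path_integral_def prod.case
proof (intro allI impI)
  fix e :: real assume "e > 0"
  let ?S = "\<lambda>g p. \<Sum>(t, K)\<in>p. g (\<gamma> t) * (\<gamma> (Sup K) - \<gamma> (Inf K))"
  obtain d1 where d1: "d1 > 0" "\<And>p. p tagged_division_of {a..b} \<Longrightarrow> (\<lambda>t. ball t d1) fine p \<Longrightarrow>
      cmod (?S g p - I) < e/2"
    by (rule has_path_integralE[OF assms(1) half_gt_zero[OF \<open>e > 0\<close>]]) (rule that)
  obtain d2 where d2: "d2 > 0" "\<And>p. p tagged_division_of {a..b} \<Longrightarrow> (\<lambda>t. ball t d2) fine p \<Longrightarrow>
      cmod (?S h p - J) < e/2"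
    by (rule has_path_integralE[OF assms(2) half_gt_zero[OF \<open>e > 0\<close>]]) (rule that)
  have "cmod (?S (\<lambda>z. g z - h z) p - (I - J)) < e"
    if p: "p tagged_division_of {a..b}" "(\<lambda>t. ball t (min d1 d2)) fine p" for p
  proof -
    have "(\<lambda>t. ball t d1) fine p" "(\<lambda>t. ball t d2) fine p"
      using p(2) unfolding fine_def by fastforce+
    then have "cmod (?S g p - I) < e/2" "cmod (?S h p - J) < e/2"
      using d1(2) d2(2) p(1) by blast+
    moreover have "?S (\<lambda>z. g z - h z) p = ?S g p - ?S h p"
      by (simp add: left_diff_distrib sum_subtractf split_def)
    moreover have "cmod (A - B - (I - J)) < e" if "cmod (A - I) < e/2" "cmod (B - J) < e/2" for A B
      using norm_triangle_ineq4[of "A - I" "B - J"] that by (simp add: algebra_simps)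
    ultimately show ?thesis
      by (simp only:)
  qed
  then show "\<exists>\<delta>>0. \<forall>p. p tagged_division_of {a..b} \<and> (\<lambda>t. ball t \<delta>) fine p \<longrightarrow>
      cmod (?S (\<lambda>z. g z - h z) p - (I - J)) < e"
    using d1(1) d2(1) by (intro exI[of _ "min d1 d2"]) auto
qed


section \<open>Derivatives along paths and complex derivatives\<close>

text \<open>For fixed z, the function x \<mapsto> f x - g z * x has derivative g w - g z at w, which
  is small near z; the mean value inequality on a ball does the rest. The point is that one \<delta>
  serves all z in X.\<close>

lemma uniform_linear_approximation:
  fixes f g :: "complex \<Rightarrow> complex"
  assumes "compact X" "open U" "X \<subseteq> U" "continuous_on U g"
    and deriv: "\<And>z. z \<in> U \<Longrightarrow> (f has_field_derivative g z) (at z)" and "e > 0"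
  obtains \<delta> where "\<delta> > 0"
    and "\<And>z x y. z \<in> X \<Longrightarrow> x \<in> ball z \<delta> \<Longrightarrow> y \<in> ball z \<delta> \<Longrightarrow>
          cmod (g z * (y - x) - (f y - f x)) \<le> e * cmod (y - x)"
proof -
  \<comment> \<open>The points x and y may lie outside X, so uniform continuity of g is taken on a
    compact neighbourhood of X inside U.\<close>
  obtain r where r: "r > 0" "(\<Union>x\<in>X. cball x r) \<subseteq> U"
    using compact_subset_open_imp_cball_epsilon_subset assms(1-3) by metis
  have "uniformly_continuous_on (\<Union>x\<in>X. cball x r) g"
    using assms(1,4) r(2)
    by (intro compact_uniformly_continuous compact_minkowski_sum_cball) (auto intro: continuous_on_subset)
  then obtain d where d: "d > 0" "\<And>x y. x \<in> (\<Union>x\<in>X. cball x r) \<Longrightarrow> y \<in> (\<Union>x\<in>X. cball x r) \<Longrightarrow>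
      dist y x < d \<Longrightarrow> dist (g y) (g x) < e"
    unfolding uniformly_continuous_on_def using \<open>e > 0\<close> by metis
  show thesis
  proof (rule that)
    show "min r d > 0"
      using r(1) d(1) by simp
    fix z x y assume z: "z \<in> X" and xy: "x \<in> ball z (min r d)" "y \<in> ball z (min r d)"
    have "cmod ((f x - g z * x) - (f y - g z * y)) \<le> e * cmod (x - y)"
    proof (rule field_differentiable_bound[OF convex_ball[of z "min r d"] _ _ xy])
      fix w assume w: "w \<in> ball z (min r d)"
      then have wK: "w \<in> cball z r"
        by auto
      then have "w \<in> U"
        using r(2) z by blast
      then have "((\<lambda>x. f x - g z * x) has_field_derivative g w - g z * 1) (at w)"
        by (intro DERIV_diff deriv DERIV_cmult DERIV_ident)
      then show "((\<lambda>x. f x - g z * x) has_field_derivative (g w - g z)) (at w within ball z (min r d))"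
        by (simp add: has_field_derivative_at_within)
      have "dist (g w) (g z) < e"
        using w wK z r(1) by (intro d(2)) (auto simp: dist_commute intro: bexI[of _ z])
      then show "cmod (g w - g z) \<le> e"
        by (simp add: dist_norm)
    qed
    then show "cmod (g z * (y - x) - (f y - f x)) \<le> e * cmod (y - x)"
      by (simp add: algebra_simps norm_minus_commute)
  qed
qed

text \<open>The increments of f over the subintervals telescope, and each summand differs from its
  increment by at most e' times the chord, so the total error is at most e' times the bound L for
  the chord sums.\<close>

lemma has_path_integral_primitive:
  assumes "compact X" "open U" "X \<subseteq> U" "continuous_on U g"
    and deriv: "\<And>z. z \<in> U \<Longrightarrow> (f has_field_derivative g z) (at z)"
    and path: "is_path_in X (a, b, \<gamma>)" and rect: "rectifiable (a, b, \<gamma>)"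
  shows "has_path_integral g (f (\<gamma> b) - f (\<gamma> a)) (a, b, \<gamma>)"
  unfolding has_path_integral_def prod.case
proof (intro allI impI)
  fix e :: real assume "e > 0"
  have "a < b" and cont: "continuous_on {a..b} \<gamma>" and im: "\<gamma> ` {a..b} \<subseteq> X"
    using path by (auto simp: is_path_in_def)
  obtain L where L: "\<And>d. d division_of {a..b} \<Longrightarrow> (\<Sum>K\<in>d. dist (\<gamma> (Inf K)) (\<gamma> (Sup K))) \<le> L"
    using rect by (auto simp: rectifiable_def)
  \<comment> \<open>The added 1 keeps the divisor positive for any real L and makes the final
    inequality strict.\<close>
  define e' where "e' = e / (\<bar>L\<bar> + 1)"
  have "e' > 0"
    using \<open>e > 0\<close> by (simp add: e'_def)
  obtain d where d: "d > 0" "\<And>z x y. z \<in> X \<Longrightarrow> x \<in> ball z d \<Longrightarrow> y \<in> ball z d \<Longrightarrow>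
          cmod (g z * (y - x) - (f y - f x)) \<le> e' * cmod (y - x)"
    using uniform_linear_approximation[OF assms(1-4) deriv \<open>e' > 0\<close>] by metis
  have "uniformly_continuous_on {a..b} \<gamma>"
    using cont by (intro compact_uniformly_continuous) auto
  then obtain d' where d': "d' > 0" "\<And>s t. s \<in> {a..b} \<Longrightarrow> t \<in> {a..b} \<Longrightarrow> dist t s < d' \<Longrightarrow>
      dist (\<gamma> t) (\<gamma> s) < d"
    unfolding uniformly_continuous_on_def using d(1) by metis
  have "cmod ((\<Sum>(t, K)\<in>p. g (\<gamma> t) * (\<gamma> (Sup K) - \<gamma> (Inf K))) - (f (\<gamma> b) - f (\<gamma> a))) < e"
    if p: "p tagged_division_of {a..b}" and fine: "(\<lambda>t. ball t d') fine p" for p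
  proof -
    have "(\<Sum>(t, K)\<in>p. f (\<gamma> (Sup K)) - f (\<gamma> (Inf K))) = f (\<gamma> b) - f (\<gamma> a)"
      using additive_tagged_division_1[of a b p "\<lambda>t. f (\<gamma> t)"] \<open>a < b\<close> p by simp
    then have "cmod ((\<Sum>(t, K)\<in>p. g (\<gamma> t) * (\<gamma> (Sup K) - \<gamma> (Inf K))) - (f (\<gamma> b) - f (\<gamma> a)))
      = cmod (\<Sum>(t, K)\<in>p. g (\<gamma> t) * (\<gamma> (Sup K) - \<gamma> (Inf K)) - (f (\<gamma> (Sup K)) - f (\<gamma> (Inf K))))"
      by (simp add: split_def sum_subtractf)
    also have "\<dots> \<le> (\<Sum>(t, K)\<in>p. e' * dist (\<gamma> (Inf K)) (\<gamma> (Sup K)))"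
    proof (rule sum_norm_le, clarify)
      fix t K assume tK: "(t, K) \<in> p"
      obtain u v where uv: "u \<le> t" "t \<le> v" "K = {u..v}" "Inf K = u" "Sup K = v" "a \<le> u" "v \<le> b"
        using tagged_division_of_real_member[OF p tK] by blast
      have "{u..v} \<subseteq> ball t d'"
        using fine tK uv(3) by (auto simp: fine_def)
      then have "u \<in> ball t d'" "v \<in> ball t d'"
        using uv(1,2) by (meson atLeastAtMost_iff order.refl order.trans subsetD)+
      then have "\<gamma> u \<in> ball (\<gamma> t) d" "\<gamma> v \<in> ball (\<gamma> t) d"
        using d'(2)[of u t] d'(2)[of v t] uv by (auto simp: dist_commute)
      moreover have "\<gamma> t \<in> X"
        using im uv by auto
      ultimately show "cmod (g (\<gamma> t) * (\<gamma> (Sup K) - \<gamma> (Inf K)) - (f (\<gamma> (Sup K)) - f (\<gamma> (Inf K))))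
          \<le> e' * dist (\<gamma> (Inf K)) (\<gamma> (Sup K))"
        using d(2)[of "\<gamma> t" "\<gamma> u" "\<gamma> v"] by (simp add: uv(4,5) dist_norm norm_minus_commute[of "\<gamma> u"])
    qed
    also have "\<dots> = e' * (\<Sum>(t, K)\<in>p. dist (\<gamma> (Inf K)) (\<gamma> (Sup K)))"
      by (simp add: split_def sum_distrib_left)
    also have "\<dots> = e' * (\<Sum>K\<in>snd ` p. dist (\<gamma> (Inf K)) (\<gamma> (Sup K)))"
      using sum_tagged_division_eq_sum_division[OF p, of \<gamma>] by simp
    also have "\<dots> \<le> e' * L"
      using L[OF division_of_tagged_division[OF p]] \<open>e' > 0\<close> by simp
    also have "\<dots> < e' * (\<bar>L\<bar> + 1)"
      using \<open>e' > 0\<close> by simp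
    also have "\<dots> = e"
      by (simp add: e'_def)
    finally show ?thesis .
  qed
  then show "\<exists>\<delta>>0. \<forall>p. p tagged_division_of {a..b} \<and> (\<lambda>t. ball t \<delta>) fine p \<longrightarrow>
      cmod ((\<Sum>(t, K)\<in>p. g (\<gamma> t) * (\<gamma> (Sup K) - \<gamma> (Inf K))) - (f (\<gamma> b) - f (\<gamma> a))) < e"
    using d'(1) by blast
qed

lemma is_F_derivative_holomorphic:
  assumes "compact X" "open U" "X \<subseteq> U" "f holomorphic_on U"
  shows "is_F_derivative (injective_rectifiable_paths X) X f (deriv f)"
proof -
  have "deriv f holomorphic_on U"
    using assms(2,4) by (rule holomorphic_deriv[rotated])
  then have cont: "continuous_on U f" "continuous_on U (deriv f)"
    using assms(4) by (auto intro: holomorphic_on_imp_continuous_on)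
  have "(f has_field_derivative deriv f z) (at z)" if "z \<in> U" for z
    using assms(2,4) that by (metis holomorphic_derivI)
  then have "has_path_integral (deriv f) (f (\<gamma> b) - f (\<gamma> a)) (a, b, \<gamma>)"
    if "(a, b, \<gamma>) \<in> injective_rectifiable_paths X" for a b \<gamma>
    using that has_path_integral_primitive[OF assms(1-3) cont(2)]
    by (auto simp: injective_rectifiable_paths_def)
  then show ?thesis
    using cont assms(3) by (auto simp: is_F_derivative_def intro: continuous_on_subset)
qed

text \<open>Along a segment a chord is proportional to the parameter step, so the sum telescopes.
  This serves both the rectifiability of segments and the estimate of difference quotients.\<close>

lemma sum_dist_linepath_tagged_division:
  fixes w z :: complex
  assumes p: "p tagged_division_of {0..1}"
  shows "(\<Sum>(t, K)\<in>p. dist (linepath z w (Inf K)) (linepath z w (Sup K))) = dist z w"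
proof -
  have "(\<Sum>(t, K)\<in>p. dist (linepath z w (Inf K)) (linepath z w (Sup K)))
      = (\<Sum>(t, K)\<in>p. Sup K * dist z w - Inf K * dist z w)"
  proof (rule sum.cong[OF refl], clarify)
    fix t K assume "(t, K) \<in> p"
    then obtain u v where uv: "u \<le> t" "t \<le> v" "K = {u..v}" "Inf K = u" "Sup K = v"
      using tagged_division_of_real_member[OF p] by metis
    have "linepath z w u - linepath z w v = (v - u) *\<^sub>R (z - w)"
      by (simp add: linepath_def algebra_simps)
    then have "dist (linepath z w u) (linepath z w v) = (v - u) * dist z w"
      using uv(1,2) by (simp add: dist_norm)
    then show "dist (linepath z w (Inf K)) (linepath z w (Sup K)) = Sup K * dist z w - Inf K * dist z w"
      by (simp add: uv(4,5) left_diff_distrib)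
  qed
  also have "\<dots> = dist z w"
    using additive_tagged_division_1[of 0 1 p "\<lambda>t. t * dist z w"] p by simp
  finally show ?thesis .
qed

lemma linepath_in_injective_rectifiable_paths:
  assumes "closed_segment z w \<subseteq> X" and "z \<noteq> w"
  shows "(0, 1, linepath z w) \<in> injective_rectifiable_paths X"
proof -
  have "rectifiable (0, 1, linepath z w)"
    unfolding rectifiable_def prod.case
  proof (intro exI allI impI)
    fix d :: "real set set" assume d: "d division_of {0..1}"
    \<comment> \<open>Tagging each interval with its left end makes the preceding lemma
      applicable.\<close>
    define p where "p = (\<lambda>K. (Inf K, K)) ` d"
    have mem: "Inf K \<in> K" if "K \<in> d" for K
    proof -
      obtain u v where "K = cbox u v" "K \<noteq> {}"
        using division_ofD(3,4)[OF d \<open>K \<in> d\<close>] by blast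
      then show ?thesis
        by simp
    qed
    have p: "p tagged_division_of {0..1}"
    proof (rule tagged_division_ofI)
      show "finite p"
        using division_ofD(1)[OF d] by (simp add: p_def)
      show "x \<in> K" "K \<subseteq> {0..1}" "\<exists>a b. K = cbox a b" if "(x, K) \<in> p" for x K
        using that mem division_ofD(2,4)[OF d] by (auto simp: p_def)
      show "interior K1 \<inter> interior K2 = {}"
        if "(x1, K1) \<in> p" "(x2, K2) \<in> p" "(x1, K1) \<noteq> (x2, K2)" for x1 K1 x2 K2
        using that division_ofD(5)[OF d, of K1 K2] by (auto simp: p_def)
      have "{K. \<exists>x. (x, K) \<in> p} = d"
        by (auto simp: p_def)
      then show "\<Union>{K. \<exists>x. (x, K) \<in> p} = {0..1}"
        using division_ofD(6)[OF d] by simp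
    qed
    have "(\<Sum>K\<in>d. dist (linepath z w (Inf K)) (linepath z w (Sup K)))
        = (\<Sum>(t, K)\<in>p. dist (linepath z w (Inf K)) (linepath z w (Sup K)))"
      unfolding p_def by (subst sum.reindex) (auto simp: inj_on_def)
    also have "\<dots> = dist z w"
      using p by (rule sum_dist_linepath_tagged_division)
    finally show "(\<Sum>K\<in>d. dist (linepath z w (Inf K)) (linepath z w (Sup K))) \<le> dist z w"
      by simp
  qed
  moreover have "inj_on (linepath z w) {0..1}"
    using assms(2) by (intro inj_on_linepath) auto
  moreover have "linepath z w ` {0..1} \<subseteq> X"
    using assms(1) linepath_image_01 by metis
  ultimately show ?thesis
    by (simp add: injective_rectifiable_paths_def is_path_in_def continuous_on_linepath)
qed

text \<open>For w near z, f w - f z is the integral of g along the segment from z to w. There g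
  stays within e of g z, so the integral differs from g z * (w - z) by at most e times the length of
  the segment.\<close>

lemma is_F_derivative_imp_has_field_derivative:
  assumes F: "is_F_derivative (injective_rectifiable_paths X) X f g" and "z \<in> interior X"
  shows "(f has_field_derivative g z) (at z)"
  unfolding has_field_derivative_def has_derivative_at_alt
proof (intro conjI allI impI)
  show "bounded_linear ((*) (g z))"
    by (rule bounded_linear_mult_right)
  fix e :: real assume "e > 0"
  obtain r where r: "r > 0" "ball z r \<subseteq> X"
    using \<open>z \<in> interior X\<close> by (meson mem_interior)
  have "continuous_on X g"
    using F by (simp add: is_F_derivative_def)
  then obtain d where d: "d > 0" "\<And>x. x \<in> X \<Longrightarrow> dist x z < d \<Longrightarrow> dist (g x) (g z) < e"
    using \<open>z \<in> interior X\<close> interior_subset \<open>e > 0\<close> unfolding continuous_on_iff by (metis subsetD)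
  have "cmod (f w - f z - g z * (w - z)) \<le> e * cmod (w - z)" if w: "cmod (w - z) < min r d" for w
  proof (cases "w = z")
    case False
    let ?\<gamma> = "linepath z w"
    have seg: "closed_segment z w \<subseteq> ball z (min r d)"
      using w r(1) d(1) by (intro closed_segment_subset) (auto simp: dist_norm norm_minus_commute)
    then have segX: "closed_segment z w \<subseteq> X"
      using r(2) subset_ball[of "min r d" r z] by (meson min.cobounded1 order.trans)
    have int: "has_path_integral g (f w - f z) (0, 1, ?\<gamma>)"
      using F linepath_in_injective_rectifiable_paths[OF segX False[symmetric]]
      unfolding is_F_derivative_def by (metis (no_types, lifting) case_prodD linepath_0' linepath_1')
    show ?thesis
    \<comment> \<open>The integral is known only as a limit of sums, so the bound is proved for one
      sum within \<eta> of it, with \<eta> arbitrary.\<close>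
    proof (rule field_le_epsilon)
      fix \<eta> :: real assume "\<eta> > 0"
      let ?S = "\<lambda>p. \<Sum>(t, K)\<in>p. g (?\<gamma> t) * (?\<gamma> (Sup K) - ?\<gamma> (Inf K))"
      obtain \<delta> where \<delta>: "\<delta> > 0" "\<And>p. p tagged_division_of {0..1} \<Longrightarrow> (\<lambda>t. ball t \<delta>) fine p \<Longrightarrow>
          cmod (?S p - (f w - f z)) < \<eta>"
        by (rule has_path_integralE[OF int \<open>\<eta> > 0\<close>]) (rule that)
      \<comment> \<open>Without a \<delta>-fine tagged division the defining property of the
        integral would be vacuous.\<close>
      obtain p where p: "p tagged_division_of {0..1::real}" "(\<lambda>t. ball t \<delta>) fine p"
        using fine_division_exists_real[OF gauge_ball_const[OF \<delta>(1)], of 0 1] by blast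
      have "(\<Sum>(t, K)\<in>p. ?\<gamma> (Sup K) - ?\<gamma> (Inf K)) = w - z"
        using additive_tagged_division_1[of 0 1 p ?\<gamma>] p(1) by (simp add: linepath_0' linepath_1')
      then have "?S p - g z * (w - z) = ?S p - g z * (\<Sum>(t, K)\<in>p. ?\<gamma> (Sup K) - ?\<gamma> (Inf K))"
        by simp
      also have "\<dots> = (\<Sum>(t, K)\<in>p. (g (?\<gamma> t) - g z) * (?\<gamma> (Sup K) - ?\<gamma> (Inf K)))"
        unfolding split_def sum_distrib_left sum_subtractf[symmetric] left_diff_distrib[symmetric] ..
      also have "cmod \<dots> \<le> (\<Sum>(t, K)\<in>p. e * dist (?\<gamma> (Inf K)) (?\<gamma> (Sup K)))"
      proof (rule sum_norm_le, clarify)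
        fix t K assume "(t, K) \<in> p"
        then have "t \<in> {0..1}"
          using tagged_division_ofD(2,3)[OF p(1)] by blast
        then have "?\<gamma> t \<in> closed_segment z w"
          using linepath_image_01 by blast
        then have "?\<gamma> t \<in> X" "dist (?\<gamma> t) z < d"
          using seg segX by (auto simp: dist_commute)
        then have "cmod (g (?\<gamma> t) - g z) \<le> e"
          using d(2) by (metis dist_norm less_imp_le)
        then show "cmod ((g (?\<gamma> t) - g z) * (?\<gamma> (Sup K) - ?\<gamma> (Inf K)))
            \<le> e * dist (?\<gamma> (Inf K)) (?\<gamma> (Sup K))"
          by (simp add: norm_mult dist_norm norm_minus_commute mult_right_mono)
      qed
      also have "\<dots> = e * (\<Sum>(t, K)\<in>p. dist (?\<gamma> (Inf K)) (?\<gamma> (Sup K)))"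
        by (simp add: split_def sum_distrib_left)
      also have "\<dots> = e * dist z w"
        using sum_dist_linepath_tagged_division[OF p(1), of z w] by simp
      finally have "cmod (?S p - g z * (w - z)) \<le> e * cmod (w - z)"
        by (simp add: dist_norm norm_minus_commute)
      moreover have "cmod (?S p - (f w - f z)) < \<eta>"
        using \<delta>(2) p by blast
      moreover have "cmod (A - C) \<le> a + \<eta>" if "cmod (B - C) \<le> a" "cmod (B - A) < \<eta>" for A B C a
        using norm_triangle_ineq4[of "B - C" "B - A"] that by simp
      ultimately show "cmod (f w - f z - g z * (w - z)) \<le> e * cmod (w - z) + \<eta>"
        by blast
    qed
  qed simp
  then show "\<exists>d>0. \<forall>y. cmod (y - z) < d \<longrightarrow> cmod (f y - f z - g z * (y - z)) \<le> e * cmod (y - z)"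
    using r(1) d(1) by (intro exI[of _ "min r d"]) auto
qed

text \<open>Both candidates are the complex derivative of f on the interior, and continuity carries
  the equality to its closure, which is X.\<close>

lemma is_F_derivative_unique:
  assumes "closed X" "X \<subseteq> closure (interior X)"
    and "is_F_derivative (injective_rectifiable_paths X) X f g"
    and "is_F_derivative (injective_rectifiable_paths X) X f h" and "z \<in> X"
  shows "g z = h z"
proof -
  have eq: "closure (interior X) = X"
    using assms(1,2) closure_minimal[OF interior_subset] by blast
  have "g z - h z = 0"
  proof (rule continuous_constant_on_closure[of "interior X" "\<lambda>z. g z - h z"])
    show "continuous_on (closure (interior X)) (\<lambda>z. g z - h z)"
      using assms(3,4) unfolding eq is_F_derivative_def by (auto intro: continuous_on_diff)
    show "g x - h x = 0" if "x \<in> interior X" for x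
      using assms(3,4) that DERIV_unique is_F_derivative_imp_has_field_derivative by fastforce
  qed (use eq \<open>z \<in> X\<close> in auto)
  then show ?thesis
    by simp
qed

text \<open>Needed because a chosen derivative is known only on X.\<close>

lemma is_F_derivative_cong:
  assumes "\<And>z. z \<in> X \<Longrightarrow> f z = f' z" "\<And>z. z \<in> X \<Longrightarrow> g z = g' z"
  shows "is_F_derivative (injective_rectifiable_paths X) X f g
    \<longleftrightarrow> is_F_derivative (injective_rectifiable_paths X) X f' g'"
proof -
  have "has_path_integral g (f (\<gamma> b) - f (\<gamma> a)) (a, b, \<gamma>)
      = has_path_integral g' (f' (\<gamma> b) - f' (\<gamma> a)) (a, b, \<gamma>)"
    if "(a, b, \<gamma>) \<in> injective_rectifiable_paths X" for a b \<gamma>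
  proof -
    have "a < b" and im: "\<gamma> ` {a..b} \<subseteq> X"
      using that by (auto simp: injective_rectifiable_paths_def is_path_in_def)
    then have "\<gamma> a \<in> X" "\<gamma> b \<in> X"
      by auto
    then show ?thesis
      using has_path_integral_cong[OF im assms(2)] assms(1) by simp
  qed
  moreover have "continuous_on X f = continuous_on X f'" "continuous_on X g = continuous_on X g'"
    using assms by (auto intro: continuous_on_cong)
  ultimately show ?thesis
    unfolding is_F_derivative_def by blast
qed

lemma is_F_derivative_diff:
  assumes "is_F_derivative \<F> X f g" "is_F_derivative \<F> X f' g'"
  shows "is_F_derivative \<F> X (\<lambda>z. f z - f' z) (\<lambda>z. g z - g' z)"
proof -
  have "has_path_integral (\<lambda>z. g z - g' z) ((f (\<gamma> b) - f' (\<gamma> b)) - (f (\<gamma> a) - f' (\<gamma> a))) (a, b, \<gamma>)"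
    if "(a, b, \<gamma>) \<in> \<F>" for a b \<gamma>
  proof -
    have "has_path_integral (\<lambda>z. g z - g' z)
        ((f (\<gamma> b) - f (\<gamma> a)) - (f' (\<gamma> b) - f' (\<gamma> a))) (a, b, \<gamma>)"
      using that assms by (intro has_path_integral_diff) (auto simp: is_F_derivative_def)
    then show ?thesis
      by (simp add: algebra_simps)
  qed
  then show ?thesis
    using assms by (auto simp: is_F_derivative_def intro: continuous_on_diff)
qed

text \<open>By congruence, the chosen derivative and \<open>\<phi> (Suc n)\<close> are derivatives
  of the same function, so uniqueness makes them agree on X. Later \<phi> consists of the
  derivatives of an analytic extension, or of differences with such derivatives.\<close>

lemma nth_F_derivative_eq:
  assumes "closed X" "X \<subseteq> closure (interior X)"
    and "\<And>n. is_F_derivative (injective_rectifiable_paths X) X (\<phi> n) (\<phi> (Suc n))"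
    and "\<And>z. z \<in> X \<Longrightarrow> f z = \<phi> 0 z" and "z \<in> X"
  shows "nth_F_derivative (injective_rectifiable_paths X) X n f z = \<phi> n z"
  using \<open>z \<in> X\<close>
proof (induction n arbitrary: z)
  case 0
  then show ?case
    using assms(4) by (simp add: nth_F_derivative_def)
next
  case (Suc n)
  let ?F = "injective_rectifiable_paths X" and ?f = "nth_F_derivative (injective_rectifiable_paths X) X n f"
  have F: "is_F_derivative ?F X ?f (\<phi> (Suc n))"
    by (rule is_F_derivative_cong[OF Suc.IH refl, THEN iffD2, OF _ assms(3)])
  then have "is_F_derivative ?F X ?f (F_derivative ?F X ?f)"
    unfolding F_derivative_def by (rule someI[where P = "is_F_derivative ?F X ?f"])
  then have "F_derivative ?F X ?f z = \<phi> (Suc n) z"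
    using is_F_derivative_unique[OF assms(1,2) _ F] Suc.prems by blast
  then show ?case
    by (simp add: nth_F_derivative_def)
qed

lemma infinitely_F_differentiableI:
  assumes "closed X" "X \<subseteq> closure (interior X)"
    and "\<And>n. is_F_derivative (injective_rectifiable_paths X) X (\<phi> n) (\<phi> (Suc n))"
    and "\<And>z. z \<in> X \<Longrightarrow> f z = \<phi> 0 z"
  shows "infinitely_F_differentiable (injective_rectifiable_paths X) X f"
  unfolding infinitely_F_differentiable_def
proof (intro allI exI)
  fix n
  show "is_F_derivative (injective_rectifiable_paths X) X
      (nth_F_derivative (injective_rectifiable_paths X) X n f) (\<phi> (Suc n))"
    by (rule is_F_derivative_cong[OF nth_F_derivative_eq[OF assms] refl, THEN iffD2, OF _ _ assms(3)])
qed

lemma is_F_derivative_nth_F_derivative: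
  assumes "infinitely_F_differentiable \<F> X f"
  shows "is_F_derivative \<F> X (nth_F_derivative \<F> X n f) (nth_F_derivative \<F> X (Suc n) f)"
proof -
  have "\<exists>g. is_F_derivative \<F> X (nth_F_derivative \<F> X n f) g"
    using assms unfolding infinitely_F_differentiable_def by (rule spec)
  then have "is_F_derivative \<F> X (nth_F_derivative \<F> X n f) (F_derivative \<F> X (nth_F_derivative \<F> X n f))"
    unfolding F_derivative_def by (rule someI_ex)
  then show ?thesis
    by (simp add: nth_F_derivative_def)
qed


section \<open>Functions with an analytic extension\<close>

text \<open>Ensures that derivatives within X are unique, so that \<open>cderiv_on\<close> is
  meaningful at every point of X.\<close>

lemma islimpt_if_subset_closure_interior:
  fixes X :: "complex set"
  assumes "X \<subseteq> closure (interior X)" "a \<in> X"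
  shows "a islimpt X"
proof (cases "a \<in> interior X")
  case False
  then have "a islimpt interior X"
    using assms by (auto simp: closure_def)
  then show ?thesis
    using interior_subset islimpt_subset by blast
qed (rule interior_limit_point)

lemma cderiv_on_eq:
  assumes "(f has_field_derivative D) (at a within X)" "a islimpt X"
  shows "cderiv_on X f a = D"
  unfolding cderiv_on_def
proof (rule the_equality)
  fix D' assume "(f has_field_derivative D') (at a within X)"
  note * = this[unfolded has_field_derivative_iff] assms(1)[unfolded has_field_derivative_iff]
  show "D' = D"
    by (rule tendsto_unique[OF _ *]) (simp add: trivial_limit_within assms(2))
qed (fact assms(1))

context
  fixes X U :: "complex set" and f h :: "complex \<Rightarrow> complex"
  assumes dense: "X \<subseteq> closure (interior X)"
    and U: "open U" "X \<subseteq> U" and hol: "h holomorphic_on U"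
    and eq: "\<And>z. z \<in> X \<Longrightarrow> f z = h z"
begin

text \<open>The conjuncts need each other: the derivative at stage n gives the value at stage n + 1,
  and that value, known on all of X, gives the derivative at stage n + 1.\<close>

lemma nth_cderiv_on_and_has_field_derivative:
  assumes "z \<in> X"
  shows "nth_cderiv_on X n f z = (deriv ^^ n) h z \<and>
    (nth_cderiv_on X n f has_field_derivative (deriv ^^ Suc n) h z) (at z within X)"
  using assms
proof (induction n arbitrary: z)
  have *: "(k has_field_derivative (deriv ^^ Suc n) h z) (at z within X)"
    if "\<And>z. z \<in> X \<Longrightarrow> k z = (deriv ^^ n) h z" "z \<in> X" for k n z
  proof -
    have "(deriv ^^ n) h holomorphic_on U"
      using hol U(1) by (rule holomorphic_higher_deriv)
    then have "((deriv ^^ n) h has_field_derivative (deriv ^^ Suc n) h z) (at z within X)"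
      using holomorphic_derivI[OF _ U(1), of _ z X] U(2) that(2) by auto
    then show ?thesis
      by (rule has_field_derivative_transform_within[where d = 1]) (use that in auto)
  qed
  {
    case 0
    have "nth_cderiv_on X 0 f = f"
      by (simp add: nth_cderiv_on_def)
    moreover have "f w = (deriv ^^ 0) h w" if "w \<in> X" for w
      using eq that by simp
    ultimately show ?case
      using *[of f 0] 0 by metis
  next
    case (Suc n)
    have "nth_cderiv_on X (Suc n) f w = (deriv ^^ Suc n) h w" if "w \<in> X" for w
    proof -
      have "cderiv_on X (nth_cderiv_on X n f) w = (deriv ^^ Suc n) h w"
        using Suc.IH[OF that] islimpt_if_subset_closure_interior[OF dense that] by (blast intro: cderiv_on_eq)
      then show ?thesis
        unfolding nth_cderiv_on_def funpow.simps comp_apply .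
    qed
    then show ?case
      using *[of "nth_cderiv_on X (Suc n) f" "Suc n"] Suc.prems by blast
  }
qed

lemma analytic_in_D_infty: "f \<in> D_infty X"
  using nth_cderiv_on_and_has_field_derivative unfolding D_infty_def field_differentiable_def by blast

lemma nth_cderiv_on_analytic: "z \<in> X \<Longrightarrow> nth_cderiv_on X n f z = (deriv ^^ n) h z"
  using nth_cderiv_on_and_has_field_derivative by blast

lemma is_F_derivative_higher_deriv:
  assumes "compact X"
  shows "is_F_derivative (injective_rectifiable_paths X) X ((deriv ^^ n) h) ((deriv ^^ Suc n) h)"
  using is_F_derivative_holomorphic[OF assms U holomorphic_higher_deriv[OF hol U(1)]] by simp

end

lemma supnorm_on_cong: "(\<And>z. z \<in> X \<Longrightarrow> f z = g z) \<Longrightarrow> supnorm_on X f = supnorm_on X g"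
  by (simp add: supnorm_on_def)

lemma weighted_norm_cong:
  "(\<And>n z. z \<in> X \<Longrightarrow> h n z = k n z) \<Longrightarrow> weighted_norm X M h = weighted_norm X M k"
  unfolding weighted_norm_def by (intro suminf_cong arg_cong2[where f = "(/)"] supnorm_on_cong) auto

text \<open>On X, the derivatives of f relative to X and those along paths are both
  \<open>(deriv ^^ n) h\<close> for the analytic extension h, so the two norms coincide.\<close>

lemma analytic_D_space_subset_DF_space:
  assumes "compact X" "X \<subseteq> closure (interior X)"
  shows "{f \<in> D_space X M. extends_analytically X f} \<subseteq> DF_space (injective_rectifiable_paths X) X M"
proof
  fix f assume "f \<in> {f \<in> D_space X M. extends_analytically X f}"
  then obtain U h where U: "open U" "X \<subseteq> U" and "h analytic_on U" and eq: "\<And>z. z \<in> X \<Longrightarrow> f z = h z"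
    and fin: "weighted_norm X M (\<lambda>n. nth_cderiv_on X n f) < \<infinity>"
    by (auto simp: D_space_def extends_analytically_def)
  then have hol: "h holomorphic_on U"
    by (simp add: analytic_imp_holomorphic)
  let ?F = "injective_rectifiable_paths X"
  have "closed X"
    using assms(1) by (rule compact_imp_closed)
  note deriv = is_F_derivative_higher_deriv[OF assms(2) U hol eq assms(1)]
  have f0: "f z = (deriv ^^ 0) h z" if "z \<in> X" for z
    using eq that by simp
  have "weighted_norm X M (\<lambda>n. nth_F_derivative ?F X n f) = weighted_norm X M (\<lambda>n. nth_cderiv_on X n f)"
    by (intro weighted_norm_cong)
      (simp add: nth_F_derivative_eq[OF \<open>closed X\<close> assms(2) deriv f0]
        nth_cderiv_on_analytic[OF assms(2) U hol eq])
  moreover have "continuous_on X f"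
    using eq holomorphic_on_imp_continuous_on[OF hol] U(2)
    by (metis continuous_on_cong continuous_on_subset)
  ultimately show "f \<in> DF_space ?F X M"
    using fin infinitely_F_differentiableI[OF \<open>closed X\<close> assms(2) deriv f0]
    by (simp add: DF_space_def DF_norm_def)
qed


section \<open>Dilations\<close>

text \<open>The definition at r = 1/t puts X into the interior of (1/t)X. The preimage of that
  interior under multiplication by 1/t is open, lies in X and contains t z.\<close>

lemma radially_self_absorbing_interior:
  assumes "radially_self_absorbing X" "0 < t" "t < 1" "z \<in> X"
  shows "complex_of_real t * z \<in> interior X"
proof (rule interiorI)
  let ?Y = "interior ((\<lambda>z. complex_of_real (1 / t) * z) ` X)"
  let ?T = "(\<lambda>w. complex_of_real (1 / t) * w) -` ?Y"
  show "open ?T"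
    by (intro open_vimage continuous_intros) auto
  have "1 / t > 1"
    using assms(2,3) by simp
  then have "X \<subseteq> ?Y"
    using assms(1) unfolding radially_self_absorbing_def by blast
  then show "complex_of_real t * z \<in> ?T"
    using assms(2,4) by auto
  show "?T \<subseteq> X"
  proof
    fix w assume "w \<in> ?T"
    then have "complex_of_real (1 / t) * w \<in> (\<lambda>z. complex_of_real (1 / t) * z) ` X"
      using interior_subset by blast
    then show "w \<in> X"
      using assms(2) by auto
  qed
qed

lemma sequence_below_one:
  obtains s :: "nat \<Rightarrow> real" where "\<And>k. 0 < s k" "\<And>k. s k < 1" "s \<longlonglongrightarrow> 1"
proof
  \<comment> \<open>The double successor makes the first term 1/2, so that every term is
    positive.\<close>
  let ?s = "\<lambda>k. 1 - inverse (real (Suc (Suc k)))"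
  show "0 < ?s k" "?s k < 1" for k
    by (auto simp: field_simps)
  have "?s \<longlonglongrightarrow> 1 - 0"
    by (rule tendsto_diff[OF tendsto_const LIMSEQ_Suc[OF LIMSEQ_inverse_real_of_nat]])
  then show "?s \<longlonglongrightarrow> 1"
    by simp
qed

lemma radially_self_absorbing_subset_closure_interior:
  assumes "radially_self_absorbing X"
  shows "X \<subseteq> closure (interior X)"
proof
  fix z assume "z \<in> X"
  obtain s :: "nat \<Rightarrow> real" where s: "\<And>k. 0 < s k" "\<And>k. s k < 1" "s \<longlonglongrightarrow> 1"
    by (rule sequence_below_one) (rule that)
  have "(\<lambda>k. complex_of_real (s k) * z) \<longlonglongrightarrow> complex_of_real 1 * z"
    by (intro tendsto_mult tendsto_of_real s(3) tendsto_const)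
  moreover have "complex_of_real (s k) * z \<in> interior X" for k
    using assms s(1,2) \<open>z \<in> X\<close> by (rule radially_self_absorbing_interior)
  ultimately show "z \<in> closure (interior X)"
    unfolding closure_sequential by (intro exI[of _ "\<lambda>k. complex_of_real (s k) * z"]) simp
qed

text \<open>Supplies the dominating series: the bound is independent of t.\<close>

lemma supnorm_on_diff_dilation_le:
  assumes "\<And>z. z \<in> X \<Longrightarrow> complex_of_real t * z \<in> X" "0 \<le> t" "t \<le> 1"
  shows "supnorm_on X (\<lambda>z. g z - complex_of_real t ^ n * g (complex_of_real t * z)) \<le> 2 * supnorm_on X g"
  unfolding supnorm_on_def
proof (rule SUP_least)
  fix z assume "z \<in> X"
  have "cmod (g z - complex_of_real t ^ n * g (complex_of_real t * z))
      \<le> cmod (g z) + t ^ n * cmod (g (complex_of_real t * z))"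
    using norm_triangle_ineq4[of "g z" "complex_of_real t ^ n * g (complex_of_real t * z)"] assms(2)
    by (simp add: norm_mult norm_power)
  also have "\<dots> \<le> cmod (g z) + cmod (g (complex_of_real t * z))"
    using assms(2,3) by (intro add_left_mono mult_left_le_one_le power_le_one) auto
  finally have "ennreal (cmod (g z - complex_of_real t ^ n * g (complex_of_real t * z)))
      \<le> ennreal (cmod (g z)) + ennreal (cmod (g (complex_of_real t * z)))"
    by (simp add: ennreal_leI flip: ennreal_plus)
  also have "\<dots> \<le> (SUP z\<in>X. ennreal (cmod (g z))) + (SUP z\<in>X. ennreal (cmod (g z)))"
    using assms(1) \<open>z \<in> X\<close> by (intro add_mono SUP_upper) auto
  finally show "ennreal (cmod (g z - complex_of_real t ^ n * g (complex_of_real t * z)))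
      \<le> 2 * (SUP z\<in>X. ennreal (cmod (g z)))"
    by (simp add: mult_2)
qed

text \<open>Keeps the norm of a dilation at most that of f, which places it in
  \<open>D_space X M\<close>.\<close>

lemma supnorm_on_dilation_le:
  assumes "\<And>z. z \<in> X \<Longrightarrow> complex_of_real t * z \<in> X" "0 \<le> t" "t \<le> 1"
  shows "supnorm_on X (\<lambda>z. complex_of_real t ^ n * g (complex_of_real t * z)) \<le> supnorm_on X g"
  unfolding supnorm_on_def
proof (rule SUP_least)
  fix z assume "z \<in> X"
  have "cmod (complex_of_real t ^ n * g (complex_of_real t * z)) \<le> cmod (g (complex_of_real t * z))"
    using assms(2,3) by (auto simp: norm_mult norm_power intro!: mult_left_le_one_le power_le_one)
  then have "ennreal (cmod (complex_of_real t ^ n * g (complex_of_real t * z)))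
      \<le> ennreal (cmod (g (complex_of_real t * z)))"
    by (rule ennreal_leI)
  also have "\<dots> \<le> (SUP z\<in>X. ennreal (cmod (g z)))"
    using assms(1) \<open>z \<in> X\<close> by (intro SUP_upper)
  finally show "ennreal (cmod (complex_of_real t ^ n * g (complex_of_real t * z)))
      \<le> (SUP z\<in>X. ennreal (cmod (g z)))" .
qed

text \<open>The factor t^n and the dilation are treated at once: t^n * g (t z) is continuous in (t,
  z) on a compact product, hence uniformly continuous, and equals g z at t = 1.\<close>

lemma tendsto_supnorm_on_diff_dilation:
  assumes "compact X" "continuous_on X g"
    and star: "\<And>t z. 0 < t \<Longrightarrow> t \<le> 1 \<Longrightarrow> z \<in> X \<Longrightarrow> complex_of_real t * z \<in> X"
    and s: "\<And>k. 0 < s k" "\<And>k. s k \<le> 1" "s \<longlonglongrightarrow> 1"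
  shows "(\<lambda>k. supnorm_on X (\<lambda>z. g z - complex_of_real (s k) ^ n * g (complex_of_real (s k) * z))) \<longlonglongrightarrow> 0"
proof -
  define \<phi> where "\<phi> = (\<lambda>(t, z). complex_of_real t ^ n * g (complex_of_real t * z))"
  \<comment> \<open>The parameter interval is compact and avoids 0, where \<open>star\<close> says
    nothing; s k eventually lies in it.\<close>
  have "continuous_on ({1/2..1} \<times> X) \<phi>"
    unfolding \<phi>_def split_def
    by (intro continuous_intros continuous_on_compose2[OF assms(2)]) (auto intro: star)
  then have "uniformly_continuous_on ({1/2..1} \<times> X) \<phi>"
    using assms(1) by (intro compact_uniformly_continuous compact_Times) auto
  note unif = this
  have "\<forall>\<^sub>F k in sequentially. supnorm_on X (\<lambda>z. g z - complex_of_real (s k) ^ n * g (complex_of_real (s k) * z))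
      \<le> ennreal e" if e: "e > 0" for e :: real
  proof -
    obtain d where d: "d > 0" "\<And>x y. x \<in> {1/2..1} \<times> X \<Longrightarrow> y \<in> {1/2..1} \<times> X \<Longrightarrow> dist y x < d \<Longrightarrow>
        dist (\<phi> y) (\<phi> x) < e"
      using unif e unfolding uniformly_continuous_on_def by metis
    have "\<forall>\<^sub>F k in sequentially. dist (s k) 1 < min d (1/2)"
      using s(3) d(1) by (intro tendstoD) auto
    then show ?thesis
    proof eventually_elim
      case (elim k)
      have "cmod (g z - complex_of_real (s k) ^ n * g (complex_of_real (s k) * z)) \<le> e" if "z \<in> X" for z
      proof -
        have "dist (\<phi> (1, z)) (\<phi> (s k, z)) < e"
          using elim that s(2)[of k]
          by (intro d(2)) (auto simp: dist_Pair_Pair dist_real_def abs_if split: if_splits)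
        then show ?thesis
          by (simp add: dist_norm \<phi>_def)
      qed
      then show ?case
        unfolding supnorm_on_def by (intro SUP_least ennreal_leI)
    qed
  qed
  note small = this
  show ?thesis
  proof (rule tendsto_zero_ennreal)
    fix r :: real assume "0 < r"
    \<comment> \<open>Pointwise bounds pass to a supremum only as \<le>; halving r restores the
      strict inequality.\<close>
    then have "ennreal (r / 2) < ennreal r"
      by (simp add: ennreal_less_iff)
    note less = le_less_trans[OF _ this]
    show "\<forall>\<^sub>F k in sequentially.
        supnorm_on X (\<lambda>z. g z - complex_of_real (s k) ^ n * g (complex_of_real (s k) * z)) < ennreal r"
      by (rule eventually_mono[OF small[OF half_gt_zero[OF \<open>0 < r\<close>]] less])
  qed
qed

text \<open>Each differentiation brings out a factor t by the chain rule. As \<open>deriv\<close>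
  depends on a neighbourhood, the induction hypothesis is used on the open preimage of V, not just
  at z.\<close>

lemma higher_deriv_dilation:
  fixes \<phi> :: "nat \<Rightarrow> complex \<Rightarrow> complex"
  assumes "open V" and "\<And>n z. z \<in> V \<Longrightarrow> (\<phi> n has_field_derivative \<phi> (Suc n) z) (at z)" "t * z \<in> V"
  shows "(deriv ^^ n) (\<lambda>z. \<phi> 0 (t * z)) z = t ^ n * \<phi> n (t * z)"
  using assms(3)
proof (induction n arbitrary: z)
  case (Suc n)
  have "open ((*) t -` V)"
    using assms(1) by (intro open_vimage continuous_intros) auto
  then have "\<forall>\<^sub>F w in nhds z. (deriv ^^ n) (\<lambda>z. \<phi> 0 (t * z)) w = t ^ n * \<phi> n (t * w)"
    using Suc by (intro eventually_nhds_in_open[THEN eventually_mono]) auto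
  then have "(deriv ^^ Suc n) (\<lambda>z. \<phi> 0 (t * z)) z = deriv (\<lambda>w. t ^ n * \<phi> n (t * w)) z"
    by (simp add: deriv_cong_ev)
  also have "\<dots> = t ^ n * (\<phi> (Suc n) (t * z) * t)"
  proof (rule DERIV_imp_deriv, rule DERIV_cmult, rule DERIV_chain2[where f = "\<phi> n" and g = "(*) t"])
    show "((*) t has_field_derivative t) (at z)"
      by (rule DERIV_cmult_Id)
  qed (rule assms(2)[OF Suc.prems])
  finally show ?case
    by simp
qed simp

theorem theorem5p11:
  fixes X :: "complex set" and M :: "nat \<Rightarrow> real"
  assumes "X \<noteq> {}" and "compact X" and "radially_self_absorbing X"
    and "\<And>n. M n > 0"
  shows "dense_in_DF_space (injective_rectifiable_paths X) X M
           {f \<in> D_space X M. extends_analytically X f}"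
  unfolding dense_in_DF_space_def
proof (intro conjI ballI allI impI)
  have dense: "X \<subseteq> closure (interior X)" and "closed X"
    by (rule radially_self_absorbing_subset_closure_interior[OF assms(3)], rule compact_imp_closed[OF assms(2)])
  show "{f \<in> D_space X M. extends_analytically X f} \<subseteq> DF_space (injective_rectifiable_paths X) X M"
    using assms(2) dense by (rule analytic_D_space_subset_DF_space)
  fix f and \<epsilon> :: real assume "f \<in> DF_space (injective_rectifiable_paths X) X M" "\<epsilon> > 0"
  define g where "g = (\<lambda>n. nth_F_derivative (injective_rectifiable_paths X) X n f)"
  have gF: "is_F_derivative (injective_rectifiable_paths X) X (g n) (g (Suc n))" for n
    using \<open>f \<in> _\<close> is_F_derivative_nth_F_derivative unfolding DF_space_def g_def by blast
  have fin: "(\<Sum>n. supnorm_on X (g n) / ennreal (M n)) < \<infinity>"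
    using \<open>f \<in> _\<close> by (simp add: DF_space_def DF_norm_def weighted_norm_def g_def)
  have g_cont: "continuous_on X (g n)" for n
    using gF by (simp add: is_F_derivative_def)
  have g_deriv: "(g n has_field_derivative g (Suc n) z) (at z)" if "z \<in> interior X" for n z
    using gF that by (rule is_F_derivative_imp_has_field_derivative)
  have g0: "g 0 = f"
    by (simp add: g_def nth_F_derivative_def)

  define h where "h = (\<lambda>t z. f (complex_of_real t * z))"
  have h: "h t \<in> D_space X M" "extends_analytically X (h t)"
      "DF_norm (injective_rectifiable_paths X) X M (\<lambda>z. f z - h t z)
        = weighted_norm X M (\<lambda>n z. g n z - complex_of_real t ^ n * g n (complex_of_real t * z))"
    if t: "0 < t" "t < 1" for t
  proof -
    \<comment> \<open>This is (1/t) times the interior of X. On it, h t evaluates f only at interior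
      points of X, where \<open>g 1\<close> is its complex derivative.\<close>
    let ?U = "(*) (complex_of_real t) -` interior X"
    have U: "open ?U"
      by (intro open_vimage continuous_intros) auto
    have XU: "X \<subseteq> ?U"
      using radially_self_absorbing_interior[OF assms(3) t] by blast
    have hol: "h t holomorphic_on ?U"
    proof (rule holomorphic_onI)
      fix z assume "z \<in> ?U"
      then have "(f has_field_derivative g 1 (complex_of_real t * z)) (at (complex_of_real t * z))"
        using g_deriv[of _ 0] g0 by simp
      then have "(h t has_field_derivative g 1 (complex_of_real t * z) * complex_of_real t) (at z)"
        unfolding h_def by (rule DERIV_chain2[where f = f]) (rule DERIV_cmult_Id)
      then show "h t field_differentiable at z within ?U"
        using field_differentiable_at_within field_differentiable_def by blast
    qed
    have deriv_h: "(deriv ^^ n) (h t) z = complex_of_real t ^ n * g n (complex_of_real t * z)"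
      if "z \<in> X" for n z
      using higher_deriv_dilation[of "interior X" g "complex_of_real t" z n] g_deriv that XU
      by (auto simp: h_def g0)
    have scale: "complex_of_real t * z \<in> X" if "z \<in> X" for z
      using that XU interior_subset by blast
    have "h t \<in> D_infty X"
      by (rule analytic_in_D_infty[OF dense U XU hol refl])
    moreover have "weighted_norm X M (\<lambda>n. nth_cderiv_on X n (h t)) \<le> weighted_norm X M g"
    proof -
      have "supnorm_on X (nth_cderiv_on X n (h t)) \<le> supnorm_on X (g n)" for n
        using supnorm_on_dilation_le[OF scale, of n "g n"] t
        by (simp add: nth_cderiv_on_analytic[OF dense U XU hol refl] deriv_h cong: supnorm_on_cong)
      then show ?thesis
        unfolding weighted_norm_def by (intro suminf_le divide_right_mono_ennreal) auto
    qed
    ultimately show "h t \<in> D_space X M"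
      using fin by (auto simp: D_space_def weighted_norm_def intro: le_less_trans)
    show "extends_analytically X (h t)"
      using U XU hol unfolding extends_analytically_def by (metis analytic_on_open)
    \<comment> \<open>A chain starting at f - h t identifies the iterated derivatives of the
      difference, although the chosen \<open>F_derivative\<close> is not known to be linear off
      X.\<close>
    have "is_F_derivative (injective_rectifiable_paths X) X
        (\<lambda>z. g n z - (deriv ^^ n) (h t) z) (\<lambda>z. g (Suc n) z - (deriv ^^ Suc n) (h t) z)" for n
      by (intro is_F_derivative_diff gF is_F_derivative_higher_deriv[OF dense U XU hol refl assms(2)])
    then have "nth_F_derivative (injective_rectifiable_paths X) X n (\<lambda>z. f z - h t z) z
        = g n z - complex_of_real t ^ n * g n (complex_of_real t * z)" if "z \<in> X" for n z
      using nth_F_derivative_eq[OF \<open>closed X\<close> dense, of "\<lambda>n z. g n z - (deriv ^^ n) (h t) z"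
          "\<lambda>z. f z - h t z"] that deriv_h g0 by simp
    then show "DF_norm (injective_rectifiable_paths X) X M (\<lambda>z. f z - h t z)
        = weighted_norm X M (\<lambda>n z. g n z - complex_of_real t ^ n * g n (complex_of_real t * z))"
      unfolding DF_norm_def by (rule weighted_norm_cong)
  qed

  obtain s :: "nat \<Rightarrow> real" where s: "\<And>k. 0 < s k" "\<And>k. s k < 1" and s_lim: "s \<longlonglongrightarrow> 1"
    by (rule sequence_below_one) (rule that)
  have scale: "complex_of_real t * z \<in> X" if "0 < t" "t \<le> 1" "z \<in> X" for t z
  proof (cases "t = 1")
    case False
    then show ?thesis
      using radially_self_absorbing_interior[OF assms(3), of t z] that interior_subset by auto
  qed (use that in simp)
  define u where "u = (\<lambda>k n. supnorm_on X
    (\<lambda>z. g n z - complex_of_real (s k) ^ n * g n (complex_of_real (s k) * z)) / ennreal (M n))"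
  \<comment> \<open>The series is written as an integral against counting measure, so that dominated
    convergence applies.\<close>
  have "(\<lambda>k. \<integral>\<^sup>+n. u k n \<partial>count_space UNIV) \<longlonglongrightarrow> (\<integral>\<^sup>+n. 0 \<partial>count_space (UNIV :: nat set))"
  proof (rule nn_integral_dominated_convergence[where w = "\<lambda>n. 2 * (supnorm_on X (g n) / ennreal (M n))"])
    show "AE n in count_space UNIV. u k n \<le> 2 * (supnorm_on X (g n) / ennreal (M n))" for k
    proof (rule AE_I2)
      fix n
      have "supnorm_on X (\<lambda>z. g n z - complex_of_real (s k) ^ n * g n (complex_of_real (s k) * z))
          \<le> 2 * supnorm_on X (g n)"
        using s[of k] by (intro supnorm_on_diff_dilation_le scale) auto
      then show "u k n \<le> 2 * (supnorm_on X (g n) / ennreal (M n))"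
        unfolding u_def ennreal_times_divide by (rule divide_right_mono_ennreal)
    qed
    show "(\<integral>\<^sup>+n. 2 * (supnorm_on X (g n) / ennreal (M n)) \<partial>count_space UNIV) < \<infinity>"
      using fin by (simp add: nn_integral_cmult nn_integral_count_space_nat ennreal_mult_less_top)
    show "AE n in count_space UNIV. (\<lambda>k. u k n) \<longlonglongrightarrow> 0"
    proof (rule AE_I2)
      fix n
      have "(\<lambda>k. supnorm_on X (\<lambda>z. g n z - complex_of_real (s k) ^ n * g n (complex_of_real (s k) * z))
          * inverse (ennreal (M n))) \<longlonglongrightarrow> 0 * inverse (ennreal (M n))"
      proof (rule tendsto_mult_ennreal[OF tendsto_supnorm_on_diff_dilation tendsto_const])
        \<comment> \<open>Multiplication of extended reals is discontinuous at 0 times \<infinity>;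
          positivity of M n makes the inverse finite.\<close>
        show "\<not> (0 = (0::ennreal) \<and> inverse (ennreal (M n)) = \<infinity> \<or> 0 = (\<infinity>::ennreal) \<and> inverse (ennreal (M n)) = 0)"
          using assms(4)[of n] by (simp add: inverse_ennreal)
      qed (use assms(2) g_cont scale s(1) s(2)[THEN less_imp_le] s_lim in auto)
      then show "(\<lambda>k. u k n) \<longlonglongrightarrow> 0"
        by (simp add: u_def divide_ennreal_def)
    qed
  qed auto
  then have "(\<lambda>k. \<Sum>n. u k n) \<longlonglongrightarrow> 0"
    by (simp add: nn_integral_count_space_nat)
  then have "\<forall>\<^sub>F k in sequentially. (\<Sum>n. u k n) < ennreal \<epsilon>"
    using \<open>\<epsilon> > 0\<close> by (intro order_tendstoD) auto
  then obtain k where "(\<Sum>n. u k n) < ennreal \<epsilon>"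
    using eventually_happens by force
  then have "DF_norm (injective_rectifiable_paths X) X M (\<lambda>z. f z - h (s k) z) < ennreal \<epsilon>"
    using h(3)[OF s] by (simp add: weighted_norm_def u_def)
  then show "\<exists>g\<in>{f \<in> D_space X M. extends_analytically X f}.
      DF_norm (injective_rectifiable_paths X) X M (\<lambda>z. f z - g z) < ennreal \<epsilon>"
    using h(1,2)[OF s] by blast
qed

end
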